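(* Suppose $r$ is a positive integer and $c\in\mathbb Z$ with $c\neq 0$. Let $b(n)$ be a polynomial in $n$ with integral coefficients and the property $b(-1-n)=(-1)^rb(n)$ for any $n\in\mathbb Z$. Define the sequence $\{u_n\}_{n\ge 0}$ of rational numbers by $$u_0=1,\quad u_1=b(0)\quad\text{and}\quad (n+1)^ru_{n+1}=b(n)u_n-cn^ru_{n-1}\quad (n\ge 1).$$ Suppose that $p$ is an odd prime with $p\nmid c$ and $u_p\in\mathbb Z_p$. For $n=0,1,2,\ldots,p-1$ we have $$u_n\equiv u_{p-1}c^nu_{p-1-n}\equiv\begin{cases} \left(\frac cp\right)c^nu_{p-1-n}\pmod p&\text{if } p\nmid u_{\frac{p-1}2},\\ (-1)^{r-1}\left(\frac cp\right)c^nu_{p-1-n}\pmod p&\text{if } p\mid u_{\frac{p-1}2}.\end{cases}$$ In particular, $$u_{p-1}\equiv \begin{cases} \left(\frac cp\right)\pmod p&\text{if } p\nmid u_{\frac{p-1}2},\\ (-1)^{r-1}\left(\frac cp\right)\pmod p&\text{if } p\mid u_{\frac{p-1}2}.\end{cases}$$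
   Context: $\mathbb Z_p$ denotes the set of rational numbers whose denominator is not divisible by $p$; congruences and divisibility modulo $p$ are taken in this ring. $\left(\frac cp\right)$ is the Legendre symbol. *)

theory Defs
  imports Complex_Main "HOL-Number_Theory.Number_Theory"
    "HOL-Computational_Algebra.Polynomial"
begin

(* quotient_of yields the fraction in lowest terms with positive denominator. *)
definition p_integers :: "nat \<Rightarrow> rat set" where
  "p_integers p = {x. \<not> int p dvd snd (quotient_of x)}"

(* The class-based dvd and cong are trivial on the field rat, so both relations
   are taken explicitly in the ring p_integers p. *)
definition p_dvd :: "nat \<Rightarrow> rat \<Rightarrow> bool" where
  "p_dvd p x \<longleftrightarrow> (\<exists>y\<in>p_integers p. x = of_nat p * y)"

definition p_cong :: "nat \<Rightarrow> rat \<Rightarrow> rat \<Rightarrow> bool" where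
  "p_cong p x y \<longleftrightarrow> x \<in> p_integers p \<and> y \<in> p_integers p \<and> p_dvd p (x - y)"

end

theory Submission
  imports Defs
begin

text \<open>
  The recurrence modulo \<open>p\<close>, together with the integrality of \<open>u p\<close>, is invariant under the
  reflection \<open>n \<mapsto> p - 1 - n\<close>: the sequence \<open>c^n u (p - 1 - n)\<close> satisfies the same recurrence as
  \<open>u n\<close>, hence is congruent to \<open>u (p - 1) u n\<close>.  Taking \<open>n = p - 1\<close> gives \<open>u (p - 1)^2 \<equiv> 1\<close>.
  The sign of \<open>u (p - 1)\<close> is read off at the middle index \<open>h = (p - 1) / 2\<close>: directly when
  \<open>u h\<close> is a unit, and otherwise from \<open>u (h - 1)\<close> and \<open>u (h + 1)\<close>, which the recurrence at \<open>h\<close>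
  then relates by a unit and which cannot vanish, since two consecutive zeros would propagate down
  to \<open>u 0 = 1\<close>.  Everything takes place among integers representing the \<open>u n\<close> modulo \<open>p\<close>.
\<close>

section \<open>The ring of \<open>p\<close>-integers\<close>

text \<open>Frees membership from lowest terms: the reduced denominator divides any \<open>d\<close>
  with \<open>d * x\<close> integral, so a single such \<open>d\<close> prime to \<open>p\<close>
  suffices. The closure lemmas then only multiply denominators.\<close>

lemma p_integers_iff:
  assumes "prime p"
  shows "x \<in> p_integers p \<longleftrightarrow> (\<exists>a d. \<not> int p dvd d \<and> of_int d * x = of_int a)"
proof
  assume x: "x \<in> p_integers p"
  obtain a d where ad: "quotient_of x = (a, d)" by fastforce
  have "x = of_int a / of_int d" "d > 0"
    using quotient_of_div[OF ad] quotient_of_denom_pos[OF ad] .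
  then have "of_int d * x = of_int a" by simp
  moreover have "\<not> int p dvd d" using x ad by (simp add: p_integers_def)
  ultimately show "\<exists>a d. \<not> int p dvd d \<and> of_int d * x = of_int a" by blast
next
  assume "\<exists>a d. \<not> int p dvd d \<and> of_int d * x = of_int a"
  then obtain a d where d: "\<not> int p dvd d" and x: "of_int d * x = of_int a" by blast
  obtain a' d' where ad: "quotient_of x = (a', d')" by fastforce
  have x': "x = of_int a' / of_int d'" "d' > 0"
    using quotient_of_div[OF ad] quotient_of_denom_pos[OF ad] .
  from x x' have "(of_int (d * a') :: rat) = of_int (a * d')" by (simp add: field_simps)
  then have "d * a' = a * d'" by (simp only: of_int_eq_iff)
  then have "d' dvd d * a'" by simp
  moreover have "coprime d' a'" using quotient_of_coprime[OF ad] by (simp add: coprime_commute)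
  ultimately have "d' dvd d" by (simp add: coprime_dvd_mult_left_iff)
  with d have "\<not> int p dvd d'" using dvd_trans by blast
  with ad show "x \<in> p_integers p" by (simp add: p_integers_def)
qed

lemma p_integers_of_int [simp]: "prime p \<Longrightarrow> of_int a \<in> p_integers p"
  by (metis mult_1 not_prime_1 of_int_1 p_integers_iff int_dvd_int_iff nat_dvd_1_iff_1 of_nat_1)

lemma p_integers_add:
  assumes p: "prime p" and "x \<in> p_integers p" "y \<in> p_integers p"
  shows "x + y \<in> p_integers p"
proof -
  obtain a d a' d' where d: "\<not> int p dvd d" "of_int d * x = of_int a"
    and d': "\<not> int p dvd d'" "of_int d' * y = of_int a'"
    using assms p_integers_iff by metis
  have "of_int (d * d') * (x + y) = of_int d' * (of_int d * x) + of_int d * (of_int d' * y)"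
    by (simp add: algebra_simps)
  also have "\<dots> = of_int (d' * a + d * a')" using d d' by simp
  finally have "of_int (d * d') * (x + y) = of_int (d' * a + d * a')" .
  moreover have "\<not> int p dvd d * d'" using p d d' by (simp add: prime_dvd_mult_iff)
  ultimately show ?thesis using p p_integers_iff by blast
qed

lemma p_integers_mult:
  assumes p: "prime p" and "x \<in> p_integers p" "y \<in> p_integers p"
  shows "x * y \<in> p_integers p"
proof -
  obtain a d a' d' where d: "\<not> int p dvd d" "of_int d * x = of_int a"
    and d': "\<not> int p dvd d'" "of_int d' * y = of_int a'"
    using assms p_integers_iff by metis
  have "of_int (d * d') * (x * y) = (of_int d * x) * (of_int d' * y)"
    by (simp add: algebra_simps)
  also have "\<dots> = of_int (a * a')" using d d' by simp
  finally have "of_int (d * d') * (x * y) = of_int (a * a')" .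
  moreover have "\<not> int p dvd d * d'" using p d d' by (simp add: prime_dvd_mult_iff)
  ultimately show ?thesis using p p_integers_iff by blast
qed

lemma p_integers_diff:
  assumes "prime p" and "x \<in> p_integers p" "y \<in> p_integers p"
  shows "x - y \<in> p_integers p"
  using p_integers_add[OF assms(1,2) p_integers_mult[OF assms(1) p_integers_of_int[OF assms(1), of "-1"] assms(3)]]
  by simp

text \<open>Integers prime to \<open>p\<close> are units of the ring; this permits dividing the
  recurrence by \<open>(n + 1) ^ r\<close>.\<close>

lemma p_integers_cancel:
  assumes p: "prime p" and d: "\<not> int p dvd d" and "of_int d * x \<in> p_integers p"
  shows "x \<in> p_integers p"
proof -
  obtain a e where e: "\<not> int p dvd e" "of_int e * (of_int d * x) = of_int a"
    using assms p_integers_iff by blast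
  then have "of_int (e * d) * x = of_int a" by (simp add: algebra_simps)
  moreover have "\<not> int p dvd e * d" using p d e by (simp add: prime_dvd_mult_iff)
  ultimately show ?thesis using p p_integers_iff by blast
qed

section \<open>Congruences in the ring of \<open>p\<close>-integers\<close>

lemma p_dvd_add: "prime p \<Longrightarrow> p_dvd p x \<Longrightarrow> p_dvd p y \<Longrightarrow> p_dvd p (x + y)"
  unfolding p_dvd_def by (metis p_integers_add distrib_left)

lemma p_dvd_mult: "prime p \<Longrightarrow> x \<in> p_integers p \<Longrightarrow> p_dvd p y \<Longrightarrow> p_dvd p (x * y)"
  unfolding p_dvd_def by (metis p_integers_mult mult.left_commute)

text \<open>Clearing the denominator \<open>d\<close> of the cofactor gives
  \<open>int p dvd d * a\<close>, and \<open>p\<close> is prime to \<open>d\<close>.\<close>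

lemma p_dvd_of_int_iff [simp]:
  assumes p: "prime p"
  shows "p_dvd p (of_int a) \<longleftrightarrow> int p dvd a"
proof
  assume "p_dvd p (of_int a)"
  then obtain y where y: "y \<in> p_integers p" "of_int a = of_nat p * y"
    unfolding p_dvd_def by blast
  obtain e d where d: "\<not> int p dvd d" "of_int d * y = of_int e"
    using y p p_integers_iff by blast
  have "(of_int (d * a) :: rat) = of_nat p * (of_int d * y)" by (simp add: y)
  also have "\<dots> = of_int (int p * e)" using d by simp
  finally have "d * a = int p * e" by (simp only: of_int_eq_iff)
  then have "int p dvd d * a" by simp
  with d p show "int p dvd a" by (simp add: prime_dvd_mult_iff)
next
  assume "int p dvd a"
  then obtain k where "a = int p * k" by blast
  then have "of_int a = of_nat p * (of_int k :: rat)" by simp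
  with p_integers_of_int[OF p, of k] show "p_dvd p (of_int a)" unfolding p_dvd_def by blast
qed

lemma p_cong_refl: "prime p \<Longrightarrow> x \<in> p_integers p \<Longrightarrow> p_cong p x x"
  using p_dvd_of_int_iff[of p 0] by (simp add: p_cong_def)

lemma p_cong_sym:
  assumes p: "prime p" and "p_cong p x y"
  shows "p_cong p y x"
proof -
  have "p_dvd p (of_int (-1) * (x - y))"
    using assms unfolding p_cong_def by (intro p_dvd_mult p_integers_of_int) auto
  moreover have "of_int (-1) * (x - y) = y - x" by simp
  ultimately show ?thesis using assms(2) by (simp only: p_cong_def)
qed

lemma p_cong_trans:
  assumes "prime p" "p_cong p x y" "p_cong p y z"
  shows "p_cong p x z"
proof -
  have "p_dvd p ((x - y) + (y - z))"
    using assms unfolding p_cong_def by (intro p_dvd_add) auto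
  moreover have "(x - y) + (y - z) = x - z" by simp
  ultimately show ?thesis using assms by (simp only: p_cong_def)
qed

lemma p_cong_diff:
  assumes p: "prime p" and x: "p_cong p x x'" and y: "p_cong p y y'"
  shows "p_cong p (x - y) (x' - y')"
proof -
  have "p_dvd p ((x - x') + (y' - y))"
    using p x p_cong_sym[OF p y] by (intro p_dvd_add) (simp_all add: p_cong_def)
  moreover have "(x - x') + (y' - y) = (x - y) - (x' - y')" by simp
  ultimately show ?thesis
    using assms by (metis p_cong_def p_integers_diff)
qed

lemma p_cong_mult:
  assumes p: "prime p" and x: "p_cong p x x'" and y: "p_cong p y y'"
  shows "p_cong p (x * y) (x' * y')"
proof -
  have "p_dvd p (x * (y - y') + y' * (x - x'))"
    using p x y by (intro p_dvd_add p_dvd_mult) (simp_all add: p_cong_def)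
  moreover have "x * (y - y') + y' * (x - x') = x * y - x' * y'"
    by (simp add: algebra_simps)
  ultimately show ?thesis
    using assms by (metis p_cong_def p_integers_mult)
qed

lemma p_cong_of_int_iff [simp]:
  "prime p \<Longrightarrow> p_cong p (of_int a) (of_int b) \<longleftrightarrow> [a = b] (mod int p)"
  using p_dvd_of_int_iff[of p "a - b"] by (simp add: p_cong_def cong_iff_dvd_diff)

section \<open>Integer representatives modulo \<open>p\<close>\<close>

lemma p_cong_of_int_transfer:
  assumes p: "prime p" and x: "p_cong p x (of_int a)" and y: "p_cong p y (of_int b)"
  shows "p_cong p x y \<longleftrightarrow> [a = b] (mod int p)"
proof -
  have "p_cong p x y \<longleftrightarrow> p_cong p (of_int a) (of_int b)"
    by (blast intro: x y p_cong_sym[OF p] p_cong_trans[OF p])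
  with p show ?thesis by simp
qed

lemma p_dvd_iff_representative:
  assumes p: "prime p" and x: "p_cong p x (of_int a)"
  shows "p_dvd p x \<longleftrightarrow> int p dvd a"
proof -
  have "p_cong p x (of_int 0) \<longleftrightarrow> [a = 0] (mod int p)"
    using p_cong_of_int_transfer[OF p x p_cong_refl[OF p p_integers_of_int[OF p, of 0]]] .
  with x p_integers_of_int[OF p, of 0] show ?thesis by (simp add: p_cong_def cong_0_iff)
qed

text \<open>If \<open>x\<close> is the fraction \<open>e / d\<close>, then \<open>d' * e\<close>
  works for any inverse \<open>d'\<close> of \<open>d\<close> modulo \<open>p\<close>.\<close>

lemma p_integers_representative:
  assumes p: "prime p" and x: "x \<in> p_integers p"
  shows "\<exists>a. p_cong p x (of_int a)"
proof -
  obtain e d where d: "\<not> int p dvd d" "of_int d * x = of_int e"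
    using x p p_integers_iff by blast
  have "coprime d (int p)" using p d by (metis coprime_commute prime_imp_coprime prime_nat_int_transfer)
  then obtain d' where d': "[d * d' = 1] (mod int p)" using cong_solve_coprime_int by blast
  have "p_cong p (of_int (d * d') * x) (of_int 1 * x)"
    using p x d' by (intro p_cong_mult p_cong_refl) (simp_all del: of_int_mult of_int_1)
  moreover have "of_int (d * d') * x = of_int (d' * e)"
    using d by (metis mult.assoc mult.commute of_int_mult)
  ultimately show ?thesis using p by (metis mult_1 of_int_1 p_cong_sym)
qed

section \<open>Reflection modulo \<open>p\<close>\<close>

lemma poly_cong_int:
  fixes b :: "int poly"
  assumes "[x = y] (mod m)"
  shows "[poly b x = poly b y] (mod m)"
  by (induction b) (auto intro!: cong_add cong_mult assms)

text \<open>At \<open>n = 0\<close> the recurrence reads \<open>[U 1 = poly b 0 * U 0] (mod int p)\<close>: the coefficient of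
  \<open>U (0 - 1)\<close> is zero because \<open>r > 0\<close>.\<close>

locale reflective_recurrence =
  fixes p r :: nat and c :: int and b :: "int poly" and U :: "nat \<Rightarrow> int"
  assumes prime: "prime p" and odd: "odd p"
    and r_pos: "r > 0"
    and c: "\<not> int p dvd c"
    and b_reflect: "poly b (- 1 - n) = (- 1) ^ r * poly b n"
    and U_0: "[U 0 = 1] (mod int p)"
    and recurrence: "n < p \<Longrightarrow>
      [(int n + 1) ^ r * U (n + 1) = poly b (int n) * U n - c * int n ^ r * U (n - 1)] (mod int p)"
begin

lemma p_gt_2: "p > 2"
  using prime odd prime_gt_1_nat[of p] by (cases "p = 2") auto

lemma coprime_iff: "coprime a (int p) \<longleftrightarrow> \<not> int p dvd a"
  using prime by (metis coprime_commute coprime_absorb_left not_prime_unit prime_imp_coprime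
      prime_nat_int_transfer)

lemma coprime_c: "coprime c (int p)"
  using c by (simp add: coprime_iff)

text \<open>The bound keeps \<open>n + 1\<close> strictly between 0 and \<open>p\<close>; at
  \<open>n = p - 1\<close> the coefficient would be \<open>p ^ r\<close>.\<close>

lemma coprime_Suc_power:
  assumes "n < p - 1"
  shows "coprime ((int n + 1) ^ r) (int p)"
proof -
  have "\<not> int p dvd int n + 1"
    using assms zdvd_imp_le[of "int p" "int n + 1"] by auto
  then show ?thesis by (simp add: coprime_iff[symmetric])
qed

text \<open>This is the recurrence at \<open>m = p - 1 - n\<close>, solved for its last term. Modulo
  \<open>p\<close>, \<open>m + 1\<close> is \<open>- n\<close> and \<open>m\<close> is
  \<open>- (n + 1)\<close>, so by \<open>b_reflect\<close> all three coefficients acquire the same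
  sign \<open>(- 1) ^ r\<close>. The case \<open>n = 0\<close> uses the recurrence at
  \<open>p - 1\<close>, which involves \<open>U p\<close>.\<close>

lemma recurrence_reflected:
  assumes "n < p - 1"
  shows "[c * (int n + 1) ^ r * U (p - 1 - (n + 1)) =
    poly b (int n) * U (p - 1 - n) - int n ^ r * U (p - n)] (mod int p)"
proof -
  define m where "m = p - 1 - n"
  have m: "m < p" "int m = int p - 1 - int n" and m': "p - 1 - (n + 1) = m - 1" "p - n = m + 1"
    using assms by (auto simp: m_def)
  have "[int m + 1 = - int n] (mod int p)" "[int m = - (int n + 1)] (mod int p)"
    "[int m = - 1 - int n] (mod int p)"
    by (simp_all add: m cong_iff_dvd_diff)
  then have 1: "[(int m + 1) ^ r = (- 1) ^ r * int n ^ r] (mod int p)"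
    and 2: "[int m ^ r = (- 1) ^ r * (int n + 1) ^ r] (mod int p)"
    and 3: "[poly b (int m) = (- 1) ^ r * poly b (int n)] (mod int p)"
    using cong_pow[of "int m + 1" "- int n" "int p" r] cong_pow[of "int m" "- (int n + 1)" "int p" r]
      poly_cong_int[of "int m" "- 1 - int n" "int p" b]
    by (simp_all add: power_minus[of "int n"] power_minus[of "int n + 1"] b_reflect
        del: minus_add_distrib)
  have "[(- 1) ^ r * int n ^ r * U (m + 1) = (int m + 1) ^ r * U (m + 1)] (mod int p)"
    using 1 by (intro cong_mult cong_refl) (simp add: cong_sym)
  also have "[(int m + 1) ^ r * U (m + 1) =
      poly b (int m) * U m - c * int m ^ r * U (m - 1)] (mod int p)"
    using recurrence m by blast
  also have "[poly b (int m) * U m - c * int m ^ r * U (m - 1) =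
      ((- 1) ^ r * poly b (int n)) * U m - c * ((- 1) ^ r * (int n + 1) ^ r) * U (m - 1)] (mod int p)"
    using 2 3 by (intro cong_mult cong_diff cong_refl)
  \<comment> \<open>A further factor \<open>(- 1) ^ r\<close> cancels the common sign, since its
    square is 1.\<close>
  finally have "[(- 1) ^ r * ((- 1) ^ r * int n ^ r * U (m + 1)) =
      (- 1) ^ r * (((- 1) ^ r * poly b (int n)) * U m -
        c * ((- 1) ^ r * (int n + 1) ^ r) * U (m - 1))] (mod int p)"
    by (intro cong_mult cong_refl)
  moreover have "((- 1) ^ r :: int) * (- 1) ^ r = 1"
    by (simp add: power_mult_distrib[symmetric])
  then have sign: "((- 1) ^ r :: int) * ((- 1) ^ r * x) = x" for x
    by (simp add: mult.assoc[symmetric])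
  have "(- 1) ^ r * ((- 1) ^ r * int n ^ r * U (m + 1)) = int n ^ r * U (m + 1)"
    by (simp only: mult.assoc sign)
  moreover have "(- 1) ^ r * (((- 1) ^ r * poly b (int n)) * U m -
        c * ((- 1) ^ r * (int n + 1) ^ r) * U (m - 1)) =
      (- 1) ^ r * ((- 1) ^ r * (poly b (int n) * U m - c * (int n + 1) ^ r * U (m - 1)))"
    by (simp only: right_diff_distrib ac_simps)
  ultimately have "[int n ^ r * U (m + 1) =
      poly b (int n) * U m - c * (int n + 1) ^ r * U (m - 1)] (mod int p)"
    by (simp only: sign)
  then have "int p dvd - (int n ^ r * U (m + 1) -
      (poly b (int n) * U m - c * (int n + 1) ^ r * U (m - 1)))"
    by (simp only: cong_iff_dvd_diff dvd_minus_iff)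
  then have "[c * (int n + 1) ^ r * U (m - 1) =
      poly b (int n) * U m - int n ^ r * U (m + 1)] (mod int p)"
    by (simp add: cong_iff_dvd_diff algebra_simps dvd_diff_commute)
  then show ?thesis by (simp only: m' flip: m_def)
qed

text \<open>Both sides satisfy the same second-order recurrence with leading coefficient invertible
  up to \<open>p - 1\<close>, and they agree at \<open>n = 0\<close> because \<open>U 0\<close> is 1
  modulo \<open>p\<close>.\<close>

lemma reflection:
  "n \<le> p - 1 \<Longrightarrow> [c ^ n * U (p - 1 - n) = U (p - 1) * U n] (mod int p)"
proof (induction n rule: less_induct)
  case (less n)
  show ?case
  proof (cases n)
    case 0
    then show ?thesis using cong_mult[OF cong_refl cong_sym[OF U_0], of "U (p - 1)"] by simp
  next
    case (Suc k)
    have k: "k < p - 1" "k < p" using less.prems Suc by auto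
    have 0: "[c ^ k * U (p - 1 - k) = U (p - 1) * U k] (mod int p)"
      using less.IH[of k] k Suc by simp
    \<comment> \<open>The factor \<open>int k ^ r\<close> makes \<open>k = 0\<close> trivial, where
      no earlier index exists; for \<open>k = Suc j\<close> this is the induction hypothesis at
      \<open>j\<close>, as \<open>p - k = p - 1 - j\<close>.\<close>
    have 1: "[int k ^ r * (c ^ k * U (p - k)) = int k ^ r * (c * (U (p - 1) * U (k - 1)))] (mod int p)"
    proof (cases k)
      case 0
      then show ?thesis using r_pos by (simp add: zero_power)
    next
      case (Suc j)
      have "[c ^ j * U (p - 1 - j) = U (p - 1) * U j] (mod int p)"
        using less.IH[of j] k Suc \<open>n = Suc k\<close> by simp
      then have "[c * (c ^ j * U (p - 1 - j)) = c * (U (p - 1) * U j)] (mod int p)"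
        by (rule cong_scalar_left)
      then show ?thesis
        using Suc by (intro cong_scalar_left[where d = "int k ^ r"]) (simp add: mult.assoc)
    qed
    have "(int k + 1) ^ r * (c ^ n * U (p - 1 - n)) =
        c ^ k * (c * (int k + 1) ^ r * U (p - 1 - (k + 1)))"
      using Suc by simp
    also have "[\<dots> = c ^ k * (poly b (int k) * U (p - 1 - k) - int k ^ r * U (p - k))] (mod int p)"
      using recurrence_reflected[OF k(1)] by (intro cong_mult cong_refl)
    also have "c ^ k * (poly b (int k) * U (p - 1 - k) - int k ^ r * U (p - k)) =
        poly b (int k) * (c ^ k * U (p - 1 - k)) - int k ^ r * (c ^ k * U (p - k))"
      by (simp add: algebra_simps)
    also have "[\<dots> = poly b (int k) * (U (p - 1) * U k) -
        int k ^ r * (c * (U (p - 1) * U (k - 1)))] (mod int p)"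
      by (intro cong_diff cong_scalar_left[OF 0] 1)
    also have "poly b (int k) * (U (p - 1) * U k) - int k ^ r * (c * (U (p - 1) * U (k - 1))) =
        U (p - 1) * (poly b (int k) * U k - c * int k ^ r * U (k - 1))"
      by (simp add: algebra_simps)
    also have "[\<dots> = U (p - 1) * ((int k + 1) ^ r * U (k + 1))] (mod int p)"
      using recurrence[OF k(2)] by (intro cong_mult cong_refl) (rule cong_sym)
    also have "U (p - 1) * ((int k + 1) ^ r * U (k + 1)) = (int k + 1) ^ r * (U (p - 1) * U n)"
      using Suc by simp
    finally show ?thesis
      using cong_mult_lcancel[OF coprime_Suc_power[OF k(1)]] by blast
  qed
qed

lemma last_squared: "[U (p - 1) * U (p - 1) = 1] (mod int p)"
proof -
  \<comment> \<open>\<open>fermat_theorem\<close> concerns naturals; passing to the absolute value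
    is harmless because \<open>p - 1\<close> is even.\<close>
  have "\<not> p dvd nat \<bar>c\<bar>"
    using c by simp
  then have "[int (nat \<bar>c\<bar> ^ (p - 1)) = int 1] (mod int p)"
    using fermat_theorem[OF prime] cong_int_iff by blast
  moreover have "int (nat \<bar>c\<bar> ^ (p - 1)) = c ^ (p - 1)"
    using odd by (simp add: power_even_abs)
  ultimately have fermat: "[c ^ (p - 1) = 1] (mod int p)" by simp
  have "[U (p - 1) * U (p - 1) = c ^ (p - 1) * U 0] (mod int p)"
    using reflection[of "p - 1"] by (simp add: cong_sym)
  also have "[c ^ (p - 1) * U 0 = 1 * 1] (mod int p)"
    by (intro cong_mult U_0 fermat)
  finally show ?thesis by simp
qed

text \<open>As \<open>U (p - 1)\<close> is its own inverse modulo \<open>p\<close>, it can be moved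
  to the other side of \<open>reflection\<close>.\<close>

lemma reflection_symmetric:
  assumes "n \<le> p - 1"
  shows "[U n = U (p - 1) * c ^ n * U (p - 1 - n)] (mod int p)"
proof -
  have "[1 * U n = (U (p - 1) * U (p - 1)) * U n] (mod int p)"
    using last_squared by (intro cong_mult cong_refl) (rule cong_sym)
  also have "(U (p - 1) * U (p - 1)) * U n = U (p - 1) * (U (p - 1) * U n)" by simp
  also have "[\<dots> = U (p - 1) * (c ^ n * U (p - 1 - n))] (mod int p)"
    using reflection[OF assms] by (intro cong_scalar_left[where d = "U (p - 1)"]) (rule cong_sym)
  finally show ?thesis by (simp add: mult.assoc)
qed

section \<open>The sign, read off at the middle index\<close>

text \<open>With two zeros in the recurrence, the remaining term is \<open>U n\<close> times a unit,
  so the pair of zeros moves down by one.\<close>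

lemma consecutive_zeros_descend:
  "n + 1 < p \<Longrightarrow> int p dvd U n \<Longrightarrow> int p dvd U (n + 1) \<Longrightarrow> int p dvd U 0"
proof (induction n)
  case (Suc n)
  have "[(int (Suc n) + 1) ^ r * U (Suc n + 1) =
      poly b (int (Suc n)) * U (Suc n) - c * int (Suc n) ^ r * U n] (mod int p)"
    using recurrence[of "Suc n"] Suc.prems by simp
  with Suc.prems(2,3) have "int p dvd c * int (Suc n) ^ r * U n"
    by (metis cong_dvd_iff dvd_diff_right_iff dvd_mult)
  moreover have "coprime (int p) (c * int (Suc n) ^ r)"
    using coprime_c coprime_Suc_power[of n] Suc.prems(1)
    by (simp add: coprime_commute add.commute)
  ultimately have "int p dvd U n" using coprime_dvd_mult_right_iff by blast
  with Suc show ?case by simp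
qed simp

lemma last_cong_Legendre:
  "[U (p - 1) = (if \<not> int p dvd U ((p - 1) div 2) then Legendre c (int p)
     else (- 1) ^ (r - 1) * Legendre c (int p))] (mod int p)"
proof -
  define h where "h = (p - 1) div 2"
  have h: "p = 2 * h + 1" "h > 0" using odd p_gt_2 unfolding h_def by presburger+
  have euler: "[Legendre c (int p) = c ^ h] (mod int p)"
    unfolding h_def using euler_criterion[OF prime p_gt_2] .
  show ?thesis
  proof (cases "int p dvd U h")
    case False
    \<comment> \<open>The index \<open>h\<close> is its own mirror image, so the unit
      \<open>U h\<close> cancels and Euler's criterion applies.\<close>
    have "[c ^ h * U h = U (p - 1) * U h] (mod int p)"
      using reflection[of h] h by simp
    with False have "[c ^ h = U (p - 1)] (mod int p)"
      using cong_mult_rcancel coprime_iff by blast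
    with euler False show ?thesis
      unfolding h_def[symmetric] by (auto intro: cong_trans cong_sym)
  next
    case True
    \<comment> \<open>The neighbours \<open>i\<close> and \<open>h + 1\<close> of \<open>h\<close>
      are mirror images; comparing \<open>reflection\<close> at \<open>i\<close> with the recurrence
      at \<open>h\<close> gives two expressions for \<open>c ^ i * U (h + 1)\<close>.\<close>
    define i where "i = h - 1"
    have i: "h = i + 1" using h by (simp add: i_def)
    have U_i: "coprime (U i) (int p)"
    proof (rule ccontr)
      assume "\<not> coprime (U i) (int p)"
      then have "int p dvd U i" by (simp add: coprime_iff)
      then have "int p dvd U 0"
        using consecutive_zeros_descend[of i] True h(1) i by (metis add_lessD1 less_add_one mult_2)
      with U_0 have "int p dvd 1" using cong_dvd_iff by blast
      with p_gt_2 show False by simp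
    qed
    have "[(int h + 1) ^ r * U (h + 1) = poly b (int h) * U h - c * int h ^ r * U i] (mod int p)"
      using recurrence[of h] h i by simp
    also have "[poly b (int h) * U h - c * int h ^ r * U i = 0 - c * int h ^ r * U i] (mod int p)"
      using True by (intro cong_diff cong_refl) (simp add: cong_0_iff)
    finally have "[(int h + 1) ^ r * U (h + 1) = - (c * int h ^ r * U i)] (mod int p)" by simp
    \<comment> \<open>Since \<open>p = 2 * h + 1\<close>, the two outer coefficients share the unit
      \<open>(int h + 1) ^ r\<close>.\<close>
    moreover have "[int h = - (int h + 1)] (mod int p)"
      by (simp add: h cong_iff_dvd_diff add.commute)
    then have "[int h ^ r = (- 1) ^ r * (int h + 1) ^ r] (mod int p)"
      using cong_pow[of "int h" "- (int h + 1)" "int p" r]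
      by (simp add: power_minus[of "int h + 1"] del: minus_add_distrib)
    then have "[- (c * int h ^ r * U i) = - (c * ((- 1) ^ r * (int h + 1) ^ r) * U i)] (mod int p)"
      by (simp only: cong_minus_minus_iff) (intro cong_mult cong_refl)
    \<comment> \<open>The minus sign of the recurrence turns \<open>(- 1) ^ r\<close> into
      \<open>(- 1) ^ (r - 1)\<close>, which for \<open>r > 0\<close> involves no truncation.\<close>
    moreover have "- (c * ((- 1) ^ r * (int h + 1) ^ r) * U i) =
        (int h + 1) ^ r * ((- 1) ^ (r - 1) * c * U i)"
      using r_pos by (cases r) auto
    ultimately have "[(int h + 1) ^ r * U (h + 1) =
        (int h + 1) ^ r * ((- 1) ^ (r - 1) * c * U i)] (mod int p)"
      using cong_trans by metis
    then have "[U (h + 1) = (- 1) ^ (r - 1) * c * U i] (mod int p)"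
      using cong_mult_lcancel[OF coprime_Suc_power[of h]] h by simp
    then have "[c ^ i * U (h + 1) = c ^ i * ((- 1) ^ (r - 1) * c * U i)] (mod int p)"
      by (intro cong_mult cong_refl)
    moreover have "[c ^ i * U (h + 1) = U (p - 1) * U i] (mod int p)"
    proof -
      have "p - 1 - i = h + 1" using h i by simp
      then show ?thesis using reflection[of i] h i by simp
    qed
    moreover have "c ^ i * ((- 1) ^ (r - 1) * c * U i) = ((- 1) ^ (r - 1) * c ^ h) * U i"
      by (simp add: i)
    ultimately have "[U (p - 1) * U i = ((- 1) ^ (r - 1) * c ^ h) * U i] (mod int p)"
      by (metis cong_sym cong_trans)
    then have "[U (p - 1) = (- 1) ^ (r - 1) * c ^ h] (mod int p)"
      using cong_mult_rcancel[OF U_i] by blast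
    also have "[(- 1) ^ (r - 1) * c ^ h = (- 1) ^ (r - 1) * Legendre c (int p)] (mod int p)"
      using euler by (intro cong_mult cong_refl) (rule cong_sym)
    finally show ?thesis using True by (simp add: h_def)
  qed
qed

end

section \<open>Transfer from integers back to the rational sequence\<close>

theorem theorem3p1:
  fixes r p :: nat and c :: int and b :: "int poly" and u :: "nat \<Rightarrow> rat"
  assumes "r > 0"
    and "c \<noteq> 0"
    and "\<forall>n::int. poly b (- 1 - n) = (- 1) ^ r * poly b n"
    and "u 0 = 1"
    and "u 1 = of_int (poly b 0)"
    and "\<forall>n\<ge>1. of_nat (n + 1) ^ r * u (n + 1)
           = of_int (poly b (int n)) * u n - of_int c * of_nat n ^ r * u (n - 1)"
    and "prime p" and "odd p"
    and "\<not> int p dvd c"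
    and "u p \<in> p_integers p"
  shows "(\<forall>n\<le>p - 1.
            p_cong p (u n) (u (p - 1) * of_int c ^ n * u (p - 1 - n)) \<and>
            p_cong p (u (p - 1) * of_int c ^ n * u (p - 1 - n))
              (if \<not> p_dvd p (u ((p - 1) div 2))
               then of_int (Legendre c (int p)) * of_int c ^ n * u (p - 1 - n)
               else (- 1) ^ (r - 1) * of_int (Legendre c (int p)) * of_int c ^ n * u (p - 1 - n))) \<and>
         p_cong p (u (p - 1))
           (if \<not> p_dvd p (u ((p - 1) div 2))
            then of_int (Legendre c (int p))
            else (- 1) ^ (r - 1) * of_int (Legendre c (int p)))"
proof -
  note p = \<open>prime p\<close>
  \<comment> \<open>One form for all \<open>n\<close>: at 0 the truncated \<open>u (0 - 1)\<close>
    is multiplied by \<open>0 ^ r = 0\<close>.\<close>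
  have rec: "of_int ((int n + 1) ^ r) * u (n + 1) =
      of_int (poly b (int n)) * u n - of_int (c * int n ^ r) * u (n - 1)" for n
  proof (cases "n = 0")
    case True
    then show ?thesis using assms(1,4,5) by (simp add: zero_power)
  next
    case False
    then show ?thesis using assms(6)[rule_format, of n] by (simp add: add.commute)
  qed
  have u_int: "u n \<in> p_integers p" if "n < p" for n
    using that
  proof (induction n rule: less_induct)
    case (less n)
    show ?case
    proof (cases n)
      case 0
      then show ?thesis using p_integers_of_int[OF p, of 1] assms(4) by simp
    next
      case (Suc k)
      have "\<not> int p dvd int k + 1"
        using less.prems Suc zdvd_imp_le[of "int p" "int k + 1"] by auto
      then have "\<not> int p dvd (int k + 1) ^ r"
        using p prime_dvd_power[of "int p"] by auto
      moreover have "u k \<in> p_integers p" "u (k - 1) \<in> p_integers p"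
        using less.IH less.prems Suc by simp_all
      then have "of_int ((int k + 1) ^ r) * u (k + 1) \<in> p_integers p"
        unfolding rec by (intro p_integers_diff p_integers_mult p_integers_of_int p)
      then have "of_int ((int k + 1) ^ r) * u n \<in> p_integers p"
        by (simp only: Suc Suc_eq_plus1)
      ultimately show ?thesis using p p_integers_cancel by blast
    qed
  qed
  \<comment> \<open>The induction stops below \<open>p\<close>, because the coefficient of
    \<open>u p\<close> is \<open>p ^ r\<close>; integrality of \<open>u p\<close> is a
    hypothesis.\<close>
  have "u n \<in> p_integers p" if "n \<le> p" for n
    using u_int assms(10) that by (cases "n = p") auto
  then have "\<forall>n. \<exists>a. n \<le> p \<longrightarrow> p_cong p (u n) (of_int a)"
    using p_integers_representative[OF p] by blast
  then obtain U where "\<forall>n. n \<le> p \<longrightarrow> p_cong p (u n) (of_int (U n))" by (rule choice[THEN exE])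
  then have U: "p_cong p (u n) (of_int (U n))" if "n \<le> p" for n using that by blast
  have const: "p_cong p (of_int a) (of_int a)" for a
    using p by simp
  interpret reflective_recurrence p r c b U
  proof
    show "[U 0 = 1] (mod int p)"
      using p_cong_of_int_iff[OF p, of 1 "U 0"] U[of 0] assms(4) by (simp add: cong_sym)
    show "[(int n + 1) ^ r * U (n + 1) = poly b (int n) * U n - c * int n ^ r * U (n - 1)] (mod int p)"
      if n: "n < p" for n
    proof -
      have "p_cong p (of_int ((int n + 1) ^ r) * u (n + 1)) (of_int ((int n + 1) ^ r) * of_int (U (n + 1)))"
        using n by (intro p_cong_mult[OF p] const U) simp
      then have lhs: "p_cong p (of_int ((int n + 1) ^ r) * u (n + 1)) (of_int ((int n + 1) ^ r * U (n + 1)))"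
        by (simp only: of_int_mult)
      have "p_cong p (of_int (poly b (int n)) * u n - of_int (c * int n ^ r) * u (n - 1))
          (of_int (poly b (int n)) * of_int (U n) - of_int (c * int n ^ r) * of_int (U (n - 1)))"
        using n by (intro p_cong_diff[OF p] p_cong_mult[OF p] const U) simp_all
      then have "p_cong p (of_int ((int n + 1) ^ r) * u (n + 1))
          (of_int (poly b (int n) * U n - c * int n ^ r * U (n - 1)))"
        by (simp only: rec of_int_diff of_int_mult)
      from p_cong_trans[OF p p_cong_sym[OF p lhs] this] show ?thesis
        using p by (simp only: p_cong_of_int_iff)
    qed
  qed (fact assms(1,7,8,9) assms(3)[rule_format])+
  \<comment> \<open>The integer sign, with its case distinction phrased for \<open>U\<close>;
    \<open>p_dvd_iff_representative\<close> matches it with the condition on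
    \<open>u\<close>.\<close>
  define s where "s = (if \<not> int p dvd U ((p - 1) div 2) then Legendre c (int p)
    else (- 1) ^ (r - 1) * Legendre c (int p))"
  have p_dvd: "p_dvd p (u ((p - 1) div 2)) \<longleftrightarrow> int p dvd U ((p - 1) div 2)"
    by (intro p_dvd_iff_representative p U) linarith
  have last: "p_cong p (u (p - 1)) (of_int s)"
    using p_cong_of_int_transfer[OF p U const, of "p - 1" s] last_cong_Legendre
    by (simp add: s_def)
  have "p_cong p (u n) (u (p - 1) * of_int c ^ n * u (p - 1 - n))"
    and "p_cong p (u (p - 1) * of_int c ^ n * u (p - 1 - n)) (of_int s * of_int c ^ n * u (p - 1 - n))"
    if n: "n \<le> p - 1" for n
  proof -
    have rhs: "p_cong p (u (p - 1) * of_int (c ^ n) * u (p - 1 - n))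
        (of_int (U (p - 1) * c ^ n * U (p - 1 - n)))"
      unfolding of_int_mult by (intro p_cong_mult p const U) simp_all
    have "n \<le> p" using n by simp
    from p_cong_of_int_transfer[OF p U[OF this] rhs] reflection_symmetric[OF n]
    show "p_cong p (u n) (u (p - 1) * of_int c ^ n * u (p - 1 - n))"
      by (simp only: of_int_power)
    have "p_cong p (u (p - 1) * of_int (c ^ n) * u (p - 1 - n))
        (of_int s * of_int (c ^ n) * u (p - 1 - n))"
      using n p_gt_2 by (intro p_cong_mult p const last p_cong_refl u_int) simp
    then show "p_cong p (u (p - 1) * of_int c ^ n * u (p - 1 - n))
        (of_int s * of_int c ^ n * u (p - 1 - n))"
      by simp
  qed
  with last show ?thesis
    unfolding p_dvd s_def by (simp split: if_splits)
qed

end
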